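(* Let $n\ge 1$ and let $r=(r_1,\ldots,r_n)$ be an $n$-tuple of positive real numbers. (1) For $1\le p<\infty$, $\overline{\sum\mathbb{R}[\underline{X}]^2}^{\|\cdot\|_{p,r}}=\mathrm{Psd}\left(\prod_{i=1}^n[-r_i^{1/p},r_i^{1/p}]\right)$. (2) $\overline{\sum\mathbb{R}[\underline{X}]^2}^{\|\cdot\|_{\infty,r}}=\mathrm{Psd}\left(\prod_{i=1}^n[-r_i,r_i]\right)$.
   Context: Here $\mathbb{R}[\underline{X}]=\mathbb{R}[X_1,\ldots,X_n]$, and $\sum\mathbb{R}[\underline{X}]^2$ is the set of all finite sums of squares of polynomials. $\mathbb{N}=\{0,1,2,\ldots\}$ and $\underline{X}^\alpha=X_1^{\alpha_1}\cdots X_n^{\alpha_n}$ for $\alpha\in\mathbb{N}^n$. For $f=\sum_{\alpha\in\mathbb{N}^n} f_\alpha\underline{X}^\alpha\in\mathbb{R}[\underline{X}]$, $\|f\|_{p,r}=\left(\sum_{\alpha}|f_\alpha|^p r_1^{\alpha_1}\cdots r_n^{\alpha_n}\right)^{1/p}$ if $1\le p<\infty$, and $\|f\|_{\infty,r}=\sup_\alpha|f_\alpha|r_1^{\alpha_1}\cdots r_n^{\alpha_n}$. The overline denotes closure in $\mathbb{R}[\underline{X}]$ with respect to the indicated norm. For $K\subseteq\mathbb{R}^n$, $\mathrm{Psd}(K)=\{f\in\mathbb{R}[\underline{X}] : f(x)\ge 0\text{ for all }x\in K\}$. *)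

theory Defs
  imports "HOL-Analysis.Analysis" "HOL-Library.Poly_Mapping"
begin

text \<open>
  The ring of real polynomials in the variables indexed by the finite type \<open>'n\<close>
  (so the number of variables is \<open>CARD('n) \<ge> 1\<close>).  A monomial is an exponent vector
  \<open>\<alpha> :: 'n \<Rightarrow>\<^sub>0 nat\<close>; a polynomial is a finitely supported map from monomials to coefficients,
  and the ring structure is the library's convolution product on \<open>\<Rightarrow>\<^sub>0\<close>.
\<close>

type_synonym 'n real_mpoly = "('n \<Rightarrow>\<^sub>0 nat) \<Rightarrow>\<^sub>0 real"

text \<open>\<open>x\<^sub>1\<^bsup>\<alpha>\<^sub>1\<^esup> \<cdots> x\<^sub>n\<^bsup>\<alpha>\<^sub>n\<^esup>\<close>; used both for evaluation and for the weights of the norms.\<close>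

definition monom_value :: "real ^ 'n::finite \<Rightarrow> ('n \<Rightarrow>\<^sub>0 nat) \<Rightarrow> real" where
  "monom_value x \<alpha> = (\<Prod>i\<in>UNIV. (x $ i) ^ Poly_Mapping.lookup \<alpha> i)"

definition mpoly_value :: "'n::finite real_mpoly \<Rightarrow> real ^ 'n \<Rightarrow> real" where
  "mpoly_value f x =
     (\<Sum>\<alpha>\<in>Poly_Mapping.keys f. Poly_Mapping.lookup f \<alpha> * monom_value x \<alpha>)"

definition Psd :: "(real ^ 'n::finite) set \<Rightarrow> 'n real_mpoly set" where
  "Psd K = {f. \<forall>x\<in>K. 0 \<le> mpoly_value f x}"

definition sums_of_squares :: "'n::finite real_mpoly set" where
  "sums_of_squares = {f. \<exists>gs. f = (\<Sum>g\<leftarrow>gs. g ^ 2)}"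

text \<open>In \<open>pnorm\<close> the terms outside \<open>keys f\<close> vanish, since \<open>0 powr p = 0\<close>.\<close>

definition pnorm :: "real \<Rightarrow> real ^ 'n::finite \<Rightarrow> 'n real_mpoly \<Rightarrow> real" where
  "pnorm p r f =
     (\<Sum>\<alpha>\<in>Poly_Mapping.keys f. \<bar>Poly_Mapping.lookup f \<alpha>\<bar> powr p * monom_value r \<alpha>)
       powr (1 / p)"

definition supnorm :: "real ^ 'n::finite \<Rightarrow> 'n real_mpoly \<Rightarrow> real" where
  "supnorm r f = (SUP \<alpha>. \<bar>Poly_Mapping.lookup f \<alpha>\<bar> * monom_value r \<alpha>)"

text \<open>
  Closure in the topology of the metric \<open>N (f - g)\<close>.  The lemmas below show that this is
  indeed a metric for the norms used, so that \<open>mtopology\<close> is the norm topology.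
\<close>

definition norm_closure ::
  "('n::finite real_mpoly \<Rightarrow> real) \<Rightarrow> 'n real_mpoly set \<Rightarrow> 'n real_mpoly set" where
  "norm_closure N S = Metric_space.mtopology UNIV (\<lambda>f g. N (f - g)) closure_of S"

lemma Metric_space_of_norm:
  fixes N :: "'a::ab_group_add \<Rightarrow> real"
  assumes nonneg: "\<And>f. 0 \<le> N f" and zero: "\<And>f. N f = 0 \<longleftrightarrow> f = 0"
    and minus: "\<And>f. N (- f) = N f" and add: "\<And>f g. N (f + g) \<le> N f + N g"
  shows "Metric_space UNIV (\<lambda>f g. N (f - g))"
proof
  show "N (x - y) = N (y - x)" for x y
    using minus[of "x - y"] by simp
  show "N (x - z) \<le> N (x - y) + N (y - z)" for x y z
    using add[of "x - y" "y - z"] by simp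
qed (auto simp: nonneg zero)

lemma monom_value_pos:
  assumes "\<And>i. 0 < r $ i"
  shows "0 < monom_value r \<alpha>"
  unfolding monom_value_def using assms by (intro prod_pos) auto

lemma powr_convex_nonneg:
  fixes x y p t :: real
  assumes "1 \<le> p" "0 \<le> x" "0 \<le> y" "0 \<le> t" "t \<le> 1"
  shows "(t * x + (1 - t) * y) powr p \<le> t * x powr p + (1 - t) * y powr p"
proof -
  have small: "(u * z) powr p \<le> u * z powr p" if "0 \<le> u" "u \<le> 1" "0 \<le> z" for u z :: real
  proof -
    have "u powr p \<le> u"
    proof (cases "u = 0")
      case False
      then have "u powr p \<le> u powr 1"
        using that assms by (intro powr_mono') auto
      then show ?thesis using that False by simp
    qed simp
    then show ?thesis
      using that by (simp add: powr_mult mult_right_mono)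
  qed
  consider "x = 0" | "y = 0" | "0 < x" "0 < y" using assms by linarith
  then show ?thesis
  proof cases
    case 1
    then show ?thesis using small[of "1 - t" y] assms by simp
  next
    case 2
    then show ?thesis using small[of t x] assms by simp
  next
    case 3
    have "convex_on {0<..} (\<lambda>x. x powr p)"
      using assms by (intro powr_convex)
    from convex_onD[OF this, of "1 - t" x y] 3 assms show ?thesis
      by simp
  qed
qed

lemma weighted_Minkowski:
  fixes a b w :: "'a \<Rightarrow> real"
  assumes "finite S" "1 \<le> p"
    and w: "\<And>s. s \<in> S \<Longrightarrow> 0 < w s"
    and a: "\<And>s. s \<in> S \<Longrightarrow> 0 \<le> a s" and b: "\<And>s. s \<in> S \<Longrightarrow> 0 \<le> b s"
  shows "(\<Sum>s\<in>S. (a s + b s) powr p * w s) powr (1/p)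
    \<le> (\<Sum>s\<in>S. a s powr p * w s) powr (1/p) + (\<Sum>s\<in>S. b s powr p * w s) powr (1/p)"
proof -
  define A where "A = (\<Sum>s\<in>S. a s powr p * w s) powr (1/p)"
  define B where "B = (\<Sum>s\<in>S. b s powr p * w s) powr (1/p)"
  have nn: "0 \<le> (\<Sum>s\<in>S. c s powr p * w s)" for c
    using w by (intro sum_nonneg) (auto simp: less_imp_le)
  have Ap: "A powr p = (\<Sum>s\<in>S. a s powr p * w s)"
    and Bp: "B powr p = (\<Sum>s\<in>S. b s powr p * w s)"
    using nn assms by (auto simp: A_def B_def powr_powr)
  have vanish: "c s = 0"
    if "(\<Sum>s\<in>S. c s powr p * w s) = 0" "s \<in> S" for c s
  proof -
    have "\<forall>s\<in>S. c s powr p * w s = 0"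
      using that w \<open>finite S\<close>
      by (subst sum_nonneg_eq_0_iff[symmetric]) (auto simp: less_imp_le)
    then show ?thesis using that w[of s] by force
  qed
  consider "A = 0" | "B = 0" | "0 < A" "0 < B"
    using powr_ge_zero unfolding A_def B_def by (metis order_le_less)
  then have "(\<Sum>s\<in>S. (a s + b s) powr p * w s) powr (1/p) \<le> A + B"
  proof cases
    case 1
    then have "\<And>s. s \<in> S \<Longrightarrow> a s = 0"
      using vanish[of a] Ap by simp
    then have "(\<Sum>s\<in>S. (a s + b s) powr p * w s) = (\<Sum>s\<in>S. b s powr p * w s)"
      by (intro sum.cong) auto
    then show ?thesis using 1 by (simp add: B_def)
  next
    case 2
    then have "\<And>s. s \<in> S \<Longrightarrow> b s = 0"
      using vanish[of b] Bp by simp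
    then have "(\<Sum>s\<in>S. (a s + b s) powr p * w s) = (\<Sum>s\<in>S. a s powr p * w s)"
      by (intro sum.cong) auto
    then show ?thesis using 2 by (simp add: A_def)
  next
    case 3
    define t where "t = A / (A + B)"
    have t: "0 \<le> t" "t \<le> 1" "1 - t = B / (A + B)"
      using 3 by (auto simp: t_def field_simps)
    have term_le: "(a s + b s) powr p * w s \<le>
        (A + B) powr p * (t * (a s powr p * w s / A powr p) + (1 - t) * (b s powr p * w s / B powr p))"
      if s: "s \<in> S" for s
    proof -
      have eq: "a s + b s = (A + B) * (t * (a s / A) + (1 - t) * (b s / B))"
      proof -
        have "(A + B) * t = A" "(A + B) * (1 - t) = B"
          unfolding t(3) unfolding t_def using 3 by auto
        then have "(A + B) * (t * (a s / A) + (1 - t) * (b s / B)) = A * (a s / A) + B * (b s / B)"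
          by (simp only: distrib_left mult.assoc[symmetric])
        then show ?thesis using 3 by simp
      qed
      have "0 \<le> a s / A" "0 \<le> b s / B"
        using a[OF s] b[OF s] 3 by auto
      then have le: "(t * (a s / A) + (1 - t) * (b s / B)) powr p
          \<le> t * (a s / A) powr p + (1 - t) * (b s / B) powr p"
        using powr_convex_nonneg[OF \<open>1 \<le> p\<close>, of "a s / A" "b s / B" t] t by simp
      have "(a s + b s) powr p = (A + B) powr p * (t * (a s / A) + (1 - t) * (b s / B)) powr p"
        unfolding eq using 3 t \<open>0 \<le> a s / A\<close> \<open>0 \<le> b s / B\<close>
        by (subst powr_mult) auto
      also have "\<dots> \<le> (A + B) powr p * (t * (a s / A) powr p + (1 - t) * (b s / B) powr p)"
        using le by (intro mult_left_mono) auto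
      finally have "(a s + b s) powr p * w s
          \<le> (A + B) powr p * (t * (a s / A) powr p + (1 - t) * (b s / B) powr p) * w s"
        using w[OF s] by (intro mult_right_mono) auto
      also have "\<dots> = (A + B) powr p *
          (t * (a s powr p * w s / A powr p) + (1 - t) * (b s powr p * w s / B powr p))"
        using 3 a[OF s] b[OF s] by (simp add: powr_divide algebra_simps)
      finally show ?thesis .
    qed
    have "(\<Sum>s\<in>S. (a s + b s) powr p * w s) \<le>
        (\<Sum>s\<in>S. (A + B) powr p *
          (t * (a s powr p * w s / A powr p) + (1 - t) * (b s powr p * w s / B powr p)))"
      by (intro sum_mono term_le)
    also have "\<dots> = (A + B) powr p * (t * ((\<Sum>s\<in>S. a s powr p * w s) / A powr p)
          + (1 - t) * ((\<Sum>s\<in>S. b s powr p * w s) / B powr p))"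
      by (simp only: sum.distrib sum_distrib_left[symmetric] sum_divide_distrib[symmetric])
    also have "\<dots> = (A + B) powr p"
      using 3 by (simp flip: Ap Bp)
    finally have "(\<Sum>s\<in>S. (a s + b s) powr p * w s) powr (1/p) \<le> ((A + B) powr p) powr (1/p)"
      using nn[of "\<lambda>s. a s + b s"] assms by (intro powr_mono2) auto
    also have "\<dots> = A + B"
      using 3 assms by (simp add: powr_powr)
    finally show ?thesis .
  qed
  then show ?thesis by (simp add: A_def B_def)
qed

lemma pnorm_superset:
  assumes "finite S" "Poly_Mapping.keys f \<subseteq> S"
  shows "pnorm p r f =
    (\<Sum>\<alpha>\<in>S. \<bar>Poly_Mapping.lookup f \<alpha>\<bar> powr p * monom_value r \<alpha>) powr (1 / p)"
proof -
  have "(\<Sum>\<alpha>\<in>Poly_Mapping.keys f. \<bar>Poly_Mapping.lookup f \<alpha>\<bar> powr p * monom_value r \<alpha>)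
      = (\<Sum>\<alpha>\<in>S. \<bar>Poly_Mapping.lookup f \<alpha>\<bar> powr p * monom_value r \<alpha>)"
    using assms by (intro sum.mono_neutral_left) (auto simp: in_keys_iff)
  then show ?thesis by (simp add: pnorm_def)
qed

lemma Metric_space_pnorm:
  assumes "1 \<le> p" "\<And>i. 0 < r $ i"
  shows "Metric_space UNIV (\<lambda>f g. pnorm p r (f - g))"
proof (rule Metric_space_of_norm)
  fix f g :: "'a real_mpoly"
  show "0 \<le> pnorm p r f"
    by (simp add: pnorm_def)
  show "pnorm p r f = 0 \<longleftrightarrow> f = 0"
  proof
    assume "pnorm p r f = 0"
    then have "(\<Sum>\<alpha>\<in>Poly_Mapping.keys f.
        \<bar>Poly_Mapping.lookup f \<alpha>\<bar> powr p * monom_value r \<alpha>) = 0"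
      using assms by (simp add: pnorm_def)
    then have "\<forall>\<alpha>\<in>Poly_Mapping.keys f.
        \<bar>Poly_Mapping.lookup f \<alpha>\<bar> powr p * monom_value r \<alpha> = 0"
      by (subst (asm) sum_nonneg_eq_0_iff)
        (auto intro!: mult_nonneg_nonneg less_imp_le[OF monom_value_pos] assms)
    moreover have "\<bar>Poly_Mapping.lookup f \<alpha>\<bar> powr p * monom_value r \<alpha> \<noteq> 0"
      if "\<alpha> \<in> Poly_Mapping.keys f" for \<alpha>
      using that monom_value_pos[OF assms(2), of \<alpha>] by (simp add: in_keys_iff)
    ultimately have "Poly_Mapping.keys f = {}"
      by blast
    then show "f = 0" by simp
  qed (simp add: pnorm_def)
  show "pnorm p r (- f) = pnorm p r f"
    by (simp add: pnorm_def)
  let ?S = "Poly_Mapping.keys f \<union> Poly_Mapping.keys g"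
  have "pnorm p r (f + g) =
      (\<Sum>\<alpha>\<in>?S. \<bar>Poly_Mapping.lookup (f + g) \<alpha>\<bar> powr p * monom_value r \<alpha>) powr (1/p)"
    by (intro pnorm_superset finite_UnI finite_keys keys_add)
  also have "\<dots> \<le> (\<Sum>\<alpha>\<in>?S. (\<bar>Poly_Mapping.lookup f \<alpha>\<bar> + \<bar>Poly_Mapping.lookup g \<alpha>\<bar>) powr p
      * monom_value r \<alpha>) powr (1/p)"
    using assms(1) less_imp_le[OF monom_value_pos[OF assms(2)]]
    by (intro powr_mono2 sum_mono mult_right_mono sum_nonneg mult_nonneg_nonneg)
      (simp_all add: lookup_add abs_triangle_ineq)
  also have "\<dots> \<le> pnorm p r f + pnorm p r g"
    using weighted_Minkowski[of ?S p "monom_value r" "\<lambda>\<alpha>. \<bar>Poly_Mapping.lookup f \<alpha>\<bar>"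
        "\<lambda>\<alpha>. \<bar>Poly_Mapping.lookup g \<alpha>\<bar>"] assms
    by (simp add: pnorm_superset[of ?S] monom_value_pos)
  finally show "pnorm p r (f + g) \<le> pnorm p r f + pnorm p r g" .
qed

lemma bdd_above_supnorm:
  "bdd_above (range (\<lambda>\<alpha>. \<bar>Poly_Mapping.lookup f \<alpha>\<bar> * monom_value r \<alpha>))"
proof -
  let ?h = "\<lambda>\<alpha>. \<bar>Poly_Mapping.lookup f \<alpha>\<bar> * monom_value r \<alpha>"
  have "range ?h \<subseteq> insert 0 (?h ` Poly_Mapping.keys f)"
    by (auto simp: in_keys_iff)
  then have "finite (range ?h)"
    by (rule finite_subset) simp
  then show ?thesis by (rule bdd_above_finite)
qed

lemma supnorm_upper: "\<bar>Poly_Mapping.lookup f \<alpha>\<bar> * monom_value r \<alpha> \<le> supnorm r f"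
  unfolding supnorm_def by (rule cSUP_upper[OF _ bdd_above_supnorm]) simp

lemma Metric_space_supnorm:
  assumes "\<And>i. 0 < r $ i"
  shows "Metric_space UNIV (\<lambda>f g. supnorm r (f - g))"
proof (rule Metric_space_of_norm)
  fix f g :: "'a real_mpoly"
  have pos: "0 < monom_value r \<alpha>" for \<alpha>
    by (rule monom_value_pos[OF assms])
  show nonneg: "0 \<le> supnorm r f"
    by (rule order_trans[OF _ supnorm_upper[of _ 0]]) (simp add: less_imp_le[OF pos])
  show "supnorm r f = 0 \<longleftrightarrow> f = 0"
  proof
    assume "supnorm r f = 0"
    then have "\<bar>Poly_Mapping.lookup f \<alpha>\<bar> * monom_value r \<alpha> \<le> 0" for \<alpha>
      using supnorm_upper[of f \<alpha> r] by simp
    then have "Poly_Mapping.lookup f \<alpha> = 0" for \<alpha>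
      using pos[of \<alpha>] by (meson abs_le_zero_iff mult_le_0_iff not_less order_less_imp_le)
    then show "f = 0" by (intro poly_mapping_eqI) simp
  qed (simp add: supnorm_def)
  show "supnorm r (- f) = supnorm r f"
    by (simp add: supnorm_def)
  have "\<bar>Poly_Mapping.lookup (f + g) \<alpha>\<bar> * monom_value r \<alpha> \<le> supnorm r f + supnorm r g" for \<alpha>
  proof -
    have "\<bar>Poly_Mapping.lookup (f + g) \<alpha>\<bar> * monom_value r \<alpha>
        \<le> (\<bar>Poly_Mapping.lookup f \<alpha>\<bar> + \<bar>Poly_Mapping.lookup g \<alpha>\<bar>) * monom_value r \<alpha>"
      using pos[of \<alpha>] by (intro mult_right_mono) (auto simp: lookup_add)
    then show ?thesis
      using supnorm_upper[of f \<alpha> r] supnorm_upper[of g \<alpha> r] by (simp add: algebra_simps)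
  qed
  then show "supnorm r (f + g) \<le> supnorm r f + supnorm r g"
    unfolding supnorm_def[of r "f + g"] by (intro cSUP_least) auto
qed

end

theory Submission
  imports Defs
begin

text \<open>
  Put \<open>R\<^sub>i = r\<^sub>i\<^bsup>1/p\<^esup>\<close>, or \<open>R = r\<close> for the supremum norm. With the rescaled coefficients
  \<open>c\<^sub>\<alpha> = \<bar>f\<^sub>\<alpha>\<bar> R\<^sup>\<alpha>\<close> the norm in question is the \<open>\<ell>\<^sup>p\<close> norm of the finite family \<open>c\<close>, so it lies between
  the supremum and the sum of the \<open>c\<^sub>\<alpha>\<close>. All the closures of the sums of squares are therefore
  squeezed between the smallest one, for the sum norm \<open>l1norm R\<close>, and the largest one, for
  \<open>supnorm R\<close>. It remains to see that the largest is contained in, and the smallest contains, the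
  polynomials that are nonnegative on the box \<open>\<bar>x\<^sub>i\<bar> \<le> R\<^sub>i\<close>
  (\<open>norm_closure_sums_of_squares\<close>).

  Upper bound (\<open>supnorm_limit_nonneg\<close>): evaluation at an interior point of the box is continuous
  for \<open>supnorm R\<close>, because \<open>\<Sum>\<^sub>\<alpha> \<bar>x\<^sup>\<alpha>\<bar> / R\<^sup>\<alpha>\<close> is a product of convergent geometric series. Limits
  of sums of squares are thus nonnegative inside the box, and on its boundary by continuity of
  polynomials.

  Lower bound (\<open>nonneg_imp_sos_l1_closure\<close>): \<open>l1norm R\<close> is submultiplicative, so the closure of the
  sums of squares is a semiring. It contains \<open>1 - z\<close> whenever \<open>z\<close> has norm at most 1, for then
  \<open>1 - z\<close> has an approximate square root (\<open>sos_l1_closure_one_minus\<close>). Hence it contains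
  \<open>Y\<^sub>i = (1 + X\<^sub>i / R\<^sub>i) / 2\<close> and \<open>1 - Y\<^sub>i\<close>, and with them all tensor products of Bernstein polynomials
  in the \<open>Y\<^sub>i\<close>. By Bernstein's theorem a polynomial that is strictly positive on the box is
  a combination of such products with nonnegative coefficients
  (\<open>mpoly_bernstein_coeff_nonneg\<close>), so it lies in the closure; for a nonnegative \<open>f\<close> use
  \<open>f + \<epsilon>\<close> and let \<open>\<epsilon>\<close> tend to 0.
\<close>

section \<open>Evaluation of polynomials\<close>

lemma monom_value_add: "monom_value x (\<alpha> + \<beta>) = monom_value x \<alpha> * monom_value x \<beta>"
  by (simp add: monom_value_def lookup_add power_add prod.distrib)

lemma monom_value_zero [simp]: "monom_value x 0 = 1"
  by (simp add: monom_value_def)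

lemma monom_value_var [simp]: "monom_value x (Poly_Mapping.single i 1) = x $ i"
proof -
  have "monom_value x (Poly_Mapping.single i 1) = (\<Prod>j\<in>UNIV. if j = i then x $ j else 1)"
    unfolding monom_value_def by (intro prod.cong) (auto simp: lookup_single when_def)
  then show ?thesis by simp
qed

lemma sum_monomials:
  fixes f :: "'n::finite real_mpoly"
  shows "f = (\<Sum>\<alpha>\<in>Poly_Mapping.keys f. Poly_Mapping.single \<alpha> (Poly_Mapping.lookup f \<alpha>))"
  by (intro poly_mapping_eqI)
     (simp add: lookup_sum lookup_single when_def sum.delta in_keys_iff)

lemma mpoly_value_superset:
  assumes "finite S" "Poly_Mapping.keys f \<subseteq> S"
  shows "mpoly_value f x = (\<Sum>\<alpha>\<in>S. Poly_Mapping.lookup f \<alpha> * monom_value x \<alpha>)"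
  unfolding mpoly_value_def using assms
  by (intro sum.mono_neutral_left) (auto simp: in_keys_iff)

lemma mpoly_value_add [simp]: "mpoly_value (f + g) x = mpoly_value f x + mpoly_value g x"
proof -
  let ?S = "Poly_Mapping.keys f \<union> Poly_Mapping.keys g"
  have "finite ?S" by simp
  then show ?thesis
    using mpoly_value_superset[of ?S] keys_add[of f g]
    by (simp add: lookup_add distrib_right sum.distrib)
qed

lemma mpoly_value_zero [simp]: "mpoly_value 0 x = 0"
  by (simp add: mpoly_value_def)

lemma mpoly_value_sum: "mpoly_value (sum f A) x = (\<Sum>a\<in>A. mpoly_value (f a) x)"
  by (induction A rule: infinite_finite_induct) auto

lemma mpoly_value_single [simp]: "mpoly_value (Poly_Mapping.single \<alpha> c) x = c * monom_value x \<alpha>"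
  by (simp add: mpoly_value_def)

lemma mult_monomials:
  fixes f g :: "'n::finite real_mpoly"
  shows "f * g = (\<Sum>\<alpha>\<in>Poly_Mapping.keys f. \<Sum>\<beta>\<in>Poly_Mapping.keys g.
    Poly_Mapping.single (\<alpha> + \<beta>) (Poly_Mapping.lookup f \<alpha> * Poly_Mapping.lookup g \<beta>))"
  by (subst sum_monomials[of f], subst sum_monomials[of g])
     (simp add: sum_product mult_single)

lemma mpoly_value_mult [simp]: "mpoly_value (f * g) x = mpoly_value f x * mpoly_value g x"
  by (subst mult_monomials)
     (simp add: mpoly_value_sum mpoly_value_def[of f] mpoly_value_def[of g] sum_product
       monom_value_add algebra_simps)

section \<open>Sums of squares\<close>

lemma mpoly_value_sums_of_squares_nonneg:
  assumes "s \<in> sums_of_squares"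
  shows "0 \<le> mpoly_value s x"
proof -
  have "0 \<le> mpoly_value (\<Sum>g\<leftarrow>gs. g ^ 2) x" for gs
    by (induction gs) (auto simp: power2_eq_square)
  then show ?thesis using assms by (auto simp: sums_of_squares_def)
qed

lemma sums_of_squares_square: "g ^ 2 \<in> sums_of_squares"
  unfolding sums_of_squares_def by (auto intro: exI[of _ "[g]"])

lemma sums_of_squares_zero: "0 \<in> sums_of_squares"
  unfolding sums_of_squares_def by (auto intro: exI[of _ "[]"])

lemma sums_of_squares_add:
  assumes "s \<in> sums_of_squares" "t \<in> sums_of_squares"
  shows "s + t \<in> sums_of_squares"
proof -
  obtain gs hs where "s = (\<Sum>g\<leftarrow>gs. g ^ 2)" "t = (\<Sum>g\<leftarrow>hs. g ^ 2)"
    using assms by (auto simp: sums_of_squares_def)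
  then have "s + t = (\<Sum>g\<leftarrow>gs @ hs. g ^ 2)" by simp
  then show ?thesis unfolding sums_of_squares_def by blast
qed

lemma sums_of_squares_mult:
  assumes "s \<in> sums_of_squares" "t \<in> sums_of_squares"
  shows "s * t \<in> sums_of_squares"
proof -
  have times_square: "(\<Sum>g\<leftarrow>gs. g ^ 2) * h ^ 2 \<in> sums_of_squares" for gs and h :: "'a real_mpoly"
  proof (induction gs)
    case (Cons g gs)
    have "(g * h) ^ 2 \<in> sums_of_squares" by (rule sums_of_squares_square)
    then show ?case
      using sums_of_squares_add[OF _ Cons.IH] by (simp add: distrib_right power_mult_distrib)
  qed (simp add: sums_of_squares_zero)
  obtain gs hs where gs: "s = (\<Sum>g\<leftarrow>gs. g ^ 2)" and hs: "t = (\<Sum>g\<leftarrow>hs. g ^ 2)"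
    using assms by (auto simp: sums_of_squares_def)
  show ?thesis unfolding hs
    by (induction hs)
       (auto simp: sums_of_squares_zero distrib_left gs intro!: sums_of_squares_add times_square)
qed

section \<open>The closure of the sums of squares in the weighted sum norm\<close>

text \<open>
  For positive weights this is \<open>pnorm 1 R\<close>, written without \<open>powr\<close>. It is the one norm of the
  family that is submultiplicative for all such weights.
\<close>

definition l1norm :: "real ^ 'n::finite \<Rightarrow> 'n real_mpoly \<Rightarrow> real" where
  "l1norm R f = (\<Sum>\<alpha>\<in>Poly_Mapping.keys f. \<bar>Poly_Mapping.lookup f \<alpha>\<bar> * monom_value R \<alpha>)"

definition sos_l1_closure :: "real ^ 'n::finite \<Rightarrow> 'n real_mpoly set" where
  "sos_l1_closure R = {f. \<forall>e>0. \<exists>s\<in>sums_of_squares. l1norm R (f - s) < e}"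

context
  fixes R :: "real ^ 'n::finite"
  assumes R: "\<And>i. 0 < R $ i"
begin

lemma l1norm_superset:
  assumes "finite S" "Poly_Mapping.keys f \<subseteq> S"
  shows "l1norm R f = (\<Sum>\<alpha>\<in>S. \<bar>Poly_Mapping.lookup f \<alpha>\<bar> * monom_value R \<alpha>)"
  unfolding l1norm_def using assms
  by (intro sum.mono_neutral_left) (auto simp: in_keys_iff)

lemma l1norm_nonneg: "0 \<le> l1norm R f"
  unfolding l1norm_def by (intro sum_nonneg mult_nonneg_nonneg less_imp_le[OF monom_value_pos] R) auto

lemma l1norm_minus: "l1norm R (- f) = l1norm R f"
  by (simp add: l1norm_def)

lemma l1norm_minus_commute: "l1norm R (f - g) = l1norm R (g - f)"
  using l1norm_minus[of "f - g"] by simp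

lemma l1norm_add: "l1norm R (f + g) \<le> l1norm R f + l1norm R g"
proof -
  let ?S = "Poly_Mapping.keys f \<union> Poly_Mapping.keys g"
  have "finite ?S" by simp
  then show ?thesis
    using l1norm_superset[of ?S] keys_add[of f g] less_imp_le[OF monom_value_pos[OF R]]
    by (simp add: lookup_add flip: sum.distrib distrib_right)
       (intro sum_mono mult_right_mono; simp add: abs_triangle_ineq)
qed

lemma l1norm_diff: "l1norm R (f - g) \<le> l1norm R f + l1norm R g"
  using l1norm_add[of f "- g"] by (simp add: l1norm_minus)

lemma l1norm_single [simp]: "l1norm R (Poly_Mapping.single \<alpha> c) = \<bar>c\<bar> * monom_value R \<alpha>"
  by (simp add: l1norm_def)

lemma l1norm_zero [simp]: "l1norm R 0 = 0"
  by (simp add: l1norm_def)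

lemma l1norm_sum: "l1norm R (sum f A) \<le> (\<Sum>a\<in>A. l1norm R (f a))"
  by (induction A rule: infinite_finite_induct) (auto intro: order_trans[OF l1norm_add])

text \<open>
  Monomials satisfy this with equality, since weights multiply; the triangle inequality does the
  rest.
\<close>

lemma l1norm_mult: "l1norm R (f * g) \<le> l1norm R f * l1norm R g"
proof -
  let ?m = "\<lambda>\<alpha> \<beta>. Poly_Mapping.single (\<alpha> + \<beta>) (Poly_Mapping.lookup f \<alpha> * Poly_Mapping.lookup g \<beta>)"
  have "l1norm R (f * g) \<le>
      (\<Sum>\<alpha>\<in>Poly_Mapping.keys f. \<Sum>\<beta>\<in>Poly_Mapping.keys g. l1norm R (?m \<alpha> \<beta>))"
    by (subst mult_monomials) (rule order_trans[OF l1norm_sum sum_mono[OF l1norm_sum]])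
  also have "\<dots> = l1norm R f * l1norm R g"
    by (simp add: l1norm_def[of R f] l1norm_def[of R g] sum_product monom_value_add
        abs_mult algebra_simps)
  finally show ?thesis .
qed

lemma sums_of_squares_in_sos_l1_closure: "s \<in> sums_of_squares \<Longrightarrow> s \<in> sos_l1_closure R"
  by (auto simp: sos_l1_closure_def intro!: bexI[of _ s])

lemma sos_l1_closure_add:
  assumes "f \<in> sos_l1_closure R" "g \<in> sos_l1_closure R"
  shows "f + g \<in> sos_l1_closure R"
  unfolding sos_l1_closure_def
proof (intro CollectI allI impI)
  fix e :: real assume "0 < e"
  then obtain s t where st: "s \<in> sums_of_squares" "t \<in> sums_of_squares"
      "l1norm R (f - s) < e / 2" "l1norm R (g - t) < e / 2"
    using assms unfolding sos_l1_closure_def by (auto dest!: spec[of _ "e / 2"])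
  have "l1norm R (f + g - (s + t)) \<le> l1norm R (f - s) + l1norm R (g - t)"
    using l1norm_add[of "f - s" "g - t"] by (simp add: algebra_simps)
  also have "\<dots> < e" using st by simp
  finally show "\<exists>s\<in>sums_of_squares. l1norm R (f + g - s) < e"
    using sums_of_squares_add[OF st(1,2)] by blast
qed

lemma sos_l1_closure_mult:
  assumes "f \<in> sos_l1_closure R" "g \<in> sos_l1_closure R"
  shows "f * g \<in> sos_l1_closure R"
  unfolding sos_l1_closure_def
proof (intro CollectI allI impI)
  fix e :: real assume e: "0 < e"
  (* Since s may have norm up to l1norm R f + 1, the two errors add up to at most d * M. *)
  define M where "M = l1norm R f + l1norm R g + 1"
  define d where "d = min 1 (e / (2 * M))"
  have M: "M > 0" using l1norm_nonneg[of f] l1norm_nonneg[of g] by (simp add: M_def)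
  have d: "d > 0" "d \<le> 1" "d * M \<le> e / 2" using M e by (auto simp: d_def field_simps min_def)
  obtain s t where st: "s \<in> sums_of_squares" "t \<in> sums_of_squares"
      "l1norm R (f - s) < d" "l1norm R (g - t) < d"
    using assms d unfolding sos_l1_closure_def by blast
  have "l1norm R s \<le> l1norm R f + l1norm R (f - s)"
    using l1norm_diff[of f "f - s"] by simp
  also have "\<dots> \<le> l1norm R f + 1" using st d by simp
  finally have s: "l1norm R s \<le> l1norm R f + 1" .
  have "l1norm R (f * g - s * t) = l1norm R ((f - s) * g + s * (g - t))"
    by (simp add: algebra_simps)
  also have "\<dots> \<le> l1norm R (f - s) * l1norm R g + l1norm R s * l1norm R (g - t)"
    by (intro order_trans[OF l1norm_add] add_mono l1norm_mult)
  also have "\<dots> \<le> d * l1norm R g + (l1norm R f + 1) * d"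
    using st s d l1norm_nonneg[of f] by (intro add_mono mult_mono) (auto simp: l1norm_nonneg)
  also have "\<dots> = d * M" by (simp add: M_def algebra_simps)
  also have "\<dots> < e" using d e by linarith
  finally show "\<exists>s\<in>sums_of_squares. l1norm R (f * g - s) < e"
    using sums_of_squares_mult[OF st(1,2)] by blast
qed

lemma sos_l1_closure_closed:
  assumes "\<And>e. 0 < e \<Longrightarrow> \<exists>g\<in>sos_l1_closure R. l1norm R (f - g) < e"
  shows "f \<in> sos_l1_closure R"
  unfolding sos_l1_closure_def
proof (intro CollectI allI impI)
  fix e :: real assume "0 < e"
  then obtain g where g: "g \<in> sos_l1_closure R" "l1norm R (f - g) < e / 2"
    using assms[of "e / 2"] by auto
  then obtain s where s: "s \<in> sums_of_squares" "l1norm R (g - s) < e / 2"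
    using \<open>0 < e\<close> unfolding sos_l1_closure_def by (auto dest!: spec[of _ "e / 2"])
  have "l1norm R (f - s) < e"
    using l1norm_add[of "f - g" "g - s"] g s by simp
  then show "\<exists>s\<in>sums_of_squares. l1norm R (f - s) < e" using s by blast
qed

lemma sos_l1_closure_const: 
  assumes "0 \<le> c"
  shows "Poly_Mapping.single 0 c \<in> sos_l1_closure R"
proof -
  have "Poly_Mapping.single 0 c = (Poly_Mapping.single 0 (sqrt c) :: 'n real_mpoly) ^ 2"
    using assms by (simp add: power2_eq_square mult_single)
  then show ?thesis using sums_of_squares_square sums_of_squares_in_sos_l1_closure by metis
qed

lemma sos_l1_closure_of_nat: "of_nat k \<in> sos_l1_closure R"
  using sos_l1_closure_const[of "of_nat k"] by simp

lemma sos_l1_closure_sum: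
  assumes "\<And>a. a \<in> A \<Longrightarrow> f a \<in> sos_l1_closure R"
  shows "sum f A \<in> sos_l1_closure R"
  using assms
  by (induction A rule: infinite_finite_induct)
     (auto intro: sos_l1_closure_add sums_of_squares_in_sos_l1_closure sums_of_squares_zero)

lemma sos_l1_closure_prod:
  assumes "\<And>a. a \<in> A \<Longrightarrow> f a \<in> sos_l1_closure R"
  shows "prod f A \<in> sos_l1_closure R"
  using assms sos_l1_closure_of_nat[of 1]
  by (induction A rule: infinite_finite_induct) (auto intro: sos_l1_closure_mult)

lemma sos_l1_closure_power:
  assumes "f \<in> sos_l1_closure R"
  shows "f ^ k \<in> sos_l1_closure R"
  using sos_l1_closure_prod[of "{..<k}" "\<lambda>_. f"] assms by simp

text \<open>
  A square root of \<open>1 - z\<close> has the form \<open>1 - u\<close> with \<open>u = (z + u\<^sup>2) / 2\<close>. The fixed point iteration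
  for \<open>u\<close> started at 0 is dominated in norm, increments included, by the same iteration \<open>a\<close> over the
  reals with \<open>z\<close> replaced by 1. That one is increasing and bounded by 1, so its increments tend
  to 0, and \<open>(1 - z) - (1 - u\<^sub>k)\<^sup>2 = 2 (u\<^sub>k - u\<^sub>k\<^sub>+\<^sub>1)\<close> is small.
\<close>

lemma sos_l1_closure_one_minus:
  assumes z: "l1norm R z \<le> 1"
  shows "1 - z \<in> sos_l1_closure R"
proof -
  define u where "u = rec_nat (0::'n real_mpoly) (\<lambda>_ v. Poly_Mapping.single 0 (1/2) * (z + v ^ 2))"
  define a where "a = rec_nat (0::real) (\<lambda>_ v. (1 + v ^ 2) / 2)"
  let ?half = "Poly_Mapping.single 0 (1/2) :: 'n real_mpoly"
  have half2: "2 * ?half = 1" "?half * 2 = 1"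
    by (simp_all add: mult_single flip: single_numeral)
  have nh: "l1norm R ?half = 1 / 2" by simp
  have u: "u 0 = 0" "u (Suc k) = ?half * (z + u k ^ 2)" for k by (simp_all add: u_def)
  have a: "a 0 = 0" "a (Suc k) = (1 + a k ^ 2) / 2" for k by (simp_all add: a_def)
  have a01: "0 \<le> a k \<and> a k \<le> 1" for k
    by (induction k) (auto simp: a power_le_one)
  have "a k \<le> a (Suc k)" for k
    using sum_squares_ge_zero[of "1 - a k" 0] by (simp add: a power2_eq_square algebra_simps)
  then have inc: "incseq a" by (rule incseq_SucI)
  have u_le: "l1norm R (u k) \<le> a k" for k
  proof (induction k)
    case (Suc k)
    have "l1norm R (u (Suc k)) \<le> 1/2 * l1norm R (z + u k * u k)"
      unfolding u power2_eq_square using l1norm_mult[of ?half] by (simp add: nh)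
    also have "\<dots> \<le> 1/2 * (1 + a k * a k)"
      using z Suc a01[of k] l1norm_nonneg
      by (intro mult_left_mono order_trans[OF l1norm_add] add_mono order_trans[OF l1norm_mult] mult_mono) auto
    finally show ?case by (simp add: a power2_eq_square)
  qed (simp add: u a)
  have du: "l1norm R (u (Suc k) - u k) \<le> a (Suc k) - a k" for k
  proof (induction k)
    case 0
    show ?case using u_le[of "Suc 0"] by (simp add: u(1) a(1))
  next
    case (Suc k)
    have "u (Suc (Suc k)) - u (Suc k) = ?half * ((u (Suc k) - u k) * (u (Suc k) + u k))"
      unfolding u(2)[of "Suc k"] by (subst (2) u(2)) (simp add: algebra_simps power2_eq_square)
    then have "l1norm R (u (Suc (Suc k)) - u (Suc k))
        \<le> 1/2 * l1norm R ((u (Suc k) - u k) * (u (Suc k) + u k))"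
      using l1norm_mult[of ?half] by (simp add: nh)
    also have "\<dots> \<le> 1/2 * ((a (Suc k) - a k) * (a (Suc k) + a k))"
      using Suc l1norm_nonneg[of "u (Suc k) - u k"]
      by (intro mult_left_mono order_trans[OF l1norm_mult] mult_mono
            order_trans[OF l1norm_add] add_mono u_le l1norm_nonneg) auto
    also have "\<dots> = a (Suc (Suc k)) - a (Suc k)"
      unfolding a(2)[of "Suc k"] by (subst (4) a(2)) (simp add: algebra_simps power2_eq_square)
    finally show ?case .
  qed
  have "convergent a"
    using inc a01 by (intro Bseq_mono_convergent BseqI'[of _ 1]) (auto simp: incseq_def)
  then obtain l where l: "a \<longlonglongrightarrow> l" by (auto simp: convergent_def)
  then have "(\<lambda>k. 2 * (a (Suc k) - a k)) \<longlonglongrightarrow> 2 * (l - l)"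
    by (intro tendsto_intros LIMSEQ_Suc)
  then have lim: "(\<lambda>k. 2 * (a (Suc k) - a k)) \<longlonglongrightarrow> 0" by simp
  show ?thesis
  proof (rule sos_l1_closure_closed)
    fix e :: real assume "0 < e"
    then obtain k where k: "2 * (a (Suc k) - a k) < e"
      using order_tendstoD(2)[OF lim] by (meson eventually_sequentially order_refl)
    have "z + u k ^ 2 = 2 * u (Suc k)"
      unfolding u by (simp add: half2 flip: mult.assoc)
    then have "(1 - z) - (1 - u k) ^ 2 = 2 * (u k - u (Suc k))"
      by (simp add: power2_eq_square algebra_simps)
    then have "(1 - z) - (1 - u k) ^ 2 = (u k - u (Suc k)) + (u k - u (Suc k))"
      by (simp only: mult_2)
    then have "l1norm R ((1 - z) - (1 - u k) ^ 2) \<le> 2 * l1norm R (u (Suc k) - u k)"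
      using l1norm_add[of "u k - u (Suc k)" "u k - u (Suc k)"]
      by (simp only: l1norm_minus_commute[of "u k" "u (Suc k)"] mult_2)
    also have "\<dots> < e" using du[of k] k by simp
    finally show "\<exists>g\<in>sos_l1_closure R. l1norm R (1 - z - g) < e"
      using sums_of_squares_in_sos_l1_closure[OF sums_of_squares_square] by blast
  qed
qed

end

section \<open>Bernstein expansion in several variables\<close>

definition bernstein :: "nat \<Rightarrow> nat \<Rightarrow> 'a::comm_ring_1 \<Rightarrow> 'a" where
  "bernstein d k y = of_nat (d choose k) * y ^ k * (1 - y) ^ (d - k)"

text \<open>
  Absorbing \<open>(d choose k) (k choose j) = (d choose j) ((d - j) choose (k - j))\<close> turns the right hand
  side into \<open>(d choose j) y\<^sup>j (y + (1 - y))\<^bsup>d-j\<^esup>\<close>. So the powers \<open>y\<^sup>j\<close> with \<open>j \<le> d\<close> have the exact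
  Bernstein coefficients \<open>(k choose j) / (d choose j)\<close>.
\<close>

lemma bernstein_power:
  fixes y :: "'a::comm_ring_1"
  assumes "j \<le> d"
  shows "of_nat (d choose j) * y ^ j = (\<Sum>k\<le>d. of_nat (k choose j) * bernstein d k y)"
proof -
  have "(\<Sum>k\<le>d. of_nat (k choose j) * bernstein d k y)
      = (\<Sum>k=j..d. of_nat (k choose j) * bernstein d k y)"
    by (intro sum.mono_neutral_right) (auto simp: binomial_eq_0)
  also have "\<dots> = (\<Sum>k=j..d. of_nat (d choose j) * y ^ j *
      (of_nat ((d - j) choose (k - j)) * y ^ (k - j) * (1 - y) ^ (d - k)))"
  proof (intro sum.cong refl)
    fix k assume k: "k \<in> {j..d}"
    have "of_nat (k choose j) * bernstein d k y
        = of_nat ((d choose k) * (k choose j)) * (y ^ k * (1 - y) ^ (d - k))"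
      by (simp add: bernstein_def algebra_simps)
    also have "(d choose k) * (k choose j) = (d choose j) * ((d - j) choose (k - j))"
      using k by (intro choose_mult) auto
    also have "y ^ k = y ^ j * y ^ (k - j)"
      using k by (simp flip: power_add)
    finally show "of_nat (k choose j) * bernstein d k y = of_nat (d choose j) * y ^ j *
      (of_nat ((d - j) choose (k - j)) * y ^ (k - j) * (1 - y) ^ (d - k))"
      by (simp add: algebra_simps)
  qed
  also have "\<dots> = of_nat (d choose j) * y ^ j *
      (\<Sum>i\<le>d - j. of_nat ((d - j) choose i) * y ^ i * (1 - y) ^ (d - j - i))"
    unfolding sum_distrib_left[symmetric]
    by (intro arg_cong[where f = "\<lambda>x. _ * x"] sum.reindex_bij_witness[of _ "\<lambda>i. i + j" "\<lambda>k. k - j"])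
       (use assms in auto)
  also have "(\<Sum>i\<le>d - j. of_nat ((d - j) choose i) * y ^ i * (1 - y) ^ (d - j - i)) = 1"
    using binomial_ring[of y "1 - y" "d - j"] by simp
  finally show ?thesis by simp
qed

lemma single0_sum:
  "Poly_Mapping.single 0 (sum f A) = (\<Sum>a\<in>A. Poly_Mapping.single 0 (f a) :: 'n::finite real_mpoly)"
  by (induction A rule: infinite_finite_induct) (auto simp: single_add)

lemma single0_mult:
  "Poly_Mapping.single 0 (a * b) = (Poly_Mapping.single 0 a * Poly_Mapping.single 0 b :: 'n::finite real_mpoly)"
  by (simp add: mult_single)

lemma single0_prod:
  "Poly_Mapping.single 0 (prod f A) = (\<Prod>a\<in>A. Poly_Mapping.single 0 (f a) :: 'n::finite real_mpoly)"
  by (induction A rule: infinite_finite_induct) (auto simp: single0_mult)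

lemma single0_power:
  "Poly_Mapping.single 0 (c ^ k) = (Poly_Mapping.single 0 c ^ k :: 'n::finite real_mpoly)"
  by (induction k) (auto simp: single0_mult)

definition mvar :: "'n::finite \<Rightarrow> 'n real_mpoly" where
  "mvar i = Poly_Mapping.single (Poly_Mapping.single i 1) 1"

text \<open>The affine coordinate that maps the edge \<open>[-R\<^sub>i, R\<^sub>i]\<close> of the box to \<open>[0, 1]\<close>.\<close>

definition unit_coord :: "real ^ 'n::finite \<Rightarrow> 'n \<Rightarrow> 'n real_mpoly" where
  "unit_coord R i = Poly_Mapping.single 0 (1/2) * (1 + Poly_Mapping.single 0 (1 / R $ i) * mvar i)"

text \<open>
  The Bernstein coefficients of \<open>(\<rho> (2 y - 1))\<^sup>m\<close>, obtained from those of \<open>y\<^sup>j\<close> by the binomial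
  theorem; for \<open>\<rho> = R\<^sub>i\<close> and \<open>y = Y\<^sub>i\<close> this polynomial is \<open>X\<^sub>i\<^sup>m\<close>.
\<close>

definition bernstein_coeff :: "real \<Rightarrow> nat \<Rightarrow> nat \<Rightarrow> nat \<Rightarrow> real" where
  "bernstein_coeff \<rho> m d k =
     \<rho> ^ m * (\<Sum>j\<le>m. of_nat (m choose j) * 2 ^ j * (- 1) ^ (m - j) *
        (of_nat (k choose j) / of_nat (d choose j)))"

lemma mvar_eq:
  assumes "R $ i \<noteq> 0"
  shows "mvar i = Poly_Mapping.single 0 (R $ i) *
    (Poly_Mapping.single 0 2 * unit_coord R i + Poly_Mapping.single 0 (- 1))"
proof -
  let ?c = "\<lambda>x. Poly_Mapping.single 0 x :: 'a real_mpoly"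
  have "?c (R $ i) * (?c 2 * unit_coord R i + ?c (- 1))
     = ?c (R $ i) * ((?c 2 * ?c (1/2)) * 1 + ?c (- 1))
      + ((?c 2 * ?c (1/2)) * (?c (R $ i) * ?c (1 / R $ i))) * mvar i"
    unfolding unit_coord_def by (simp only: algebra_simps)
  also have "\<dots> = mvar i"
    using assms by (simp add: single_uminus flip: single0_mult del: single_numeral)
  finally show ?thesis by simp
qed

lemma mvar_power_bernstein:
  assumes R: "R $ i \<noteq> 0" and m: "m \<le> d"
  shows "mvar i ^ m = (\<Sum>k\<le>d. Poly_Mapping.single 0 (bernstein_coeff (R $ i) m d k) *
    bernstein d k (unit_coord R i))"
proof -
  let ?c = "\<lambda>x. Poly_Mapping.single 0 x :: 'a real_mpoly"
  let ?Y = "unit_coord R i"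
  have pow: "?Y ^ j = (\<Sum>k\<le>d. ?c (of_nat (k choose j) / of_nat (d choose j)) * bernstein d k ?Y)"
    if "j \<le> m" for j
  proof -
    have "(d choose j) > 0" using that m by simp
    then have "?Y ^ j = ?c (1 / of_nat (d choose j)) * ?c (of_nat (d choose j)) * ?Y ^ j"
      by (simp flip: single0_mult del: single_of_nat)
    also have "\<dots> = ?c (1 / of_nat (d choose j)) * (of_nat (d choose j) * ?Y ^ j)"
      by (simp add: mult.assoc)
    also have "\<dots> = (\<Sum>k\<le>d. ?c (1 / of_nat (d choose j)) * ?c (of_nat (k choose j)) * bernstein d k ?Y)"
      using that m by (subst bernstein_power) (auto simp: sum_distrib_left mult.assoc)
    finally show ?thesis by (simp flip: single0_mult del: single_of_nat)
  qed
  have "mvar i ^ m = ?c (R $ i ^ m) * (?c 2 * ?Y + ?c (- 1)) ^ m"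
    by (subst mvar_eq[of R, OF R]) (simp only: power_mult_distrib single0_power)
  also have "(?c 2 * ?Y + ?c (- 1)) ^ m =
      (\<Sum>j\<le>m. ?c (of_nat (m choose j) * 2 ^ j * (- 1) ^ (m - j)) * ?Y ^ j)"
    unfolding binomial_ring
    by (intro sum.cong refl)
       (simp only: single0_mult single0_power power_mult_distrib single_of_nat algebra_simps)
  also have "\<dots> = (\<Sum>j\<le>m. \<Sum>k\<le>d. ?c (of_nat (m choose j) * 2 ^ j * (- 1) ^ (m - j) *
      (of_nat (k choose j) / of_nat (d choose j))) * bernstein d k ?Y)"
    by (intro sum.cong refl, subst pow)
       (simp_all only: atMost_iff sum_distrib_left single0_mult mult.assoc)
  also have "\<dots> = (\<Sum>k\<le>d. ?c (\<Sum>j\<le>m. of_nat (m choose j) * 2 ^ j * (- 1) ^ (m - j) *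
      (of_nat (k choose j) / of_nat (d choose j))) * bernstein d k ?Y)"
    by (subst sum.swap) (simp only: single0_sum sum_distrib_right)
  finally have "mvar i ^ m = ?c (R $ i ^ m) * (\<Sum>k\<le>d. ?c (\<Sum>j\<le>m.
      of_nat (m choose j) * 2 ^ j * (- 1) ^ (m - j) *
      (of_nat (k choose j) / of_nat (d choose j))) * bernstein d k ?Y)" .
  moreover have "?c (bernstein_coeff (R $ i) m d k) = ?c (R $ i ^ m) *
      ?c (\<Sum>j\<le>m. of_nat (m choose j) * 2 ^ j * (- 1) ^ (m - j) *
        (of_nat (k choose j) / of_nat (d choose j)))" for k
    by (simp only: bernstein_coeff_def single0_mult)
  ultimately show ?thesis
    by (simp only: sum_distrib_left mult.assoc)
qed

lemma single_eq_prod_mvar: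
  fixes \<alpha> :: "'n::finite \<Rightarrow>\<^sub>0 nat"
  shows "Poly_Mapping.single \<alpha> (c::real) =
    Poly_Mapping.single 0 c * (\<Prod>i\<in>UNIV. mvar i ^ Poly_Mapping.lookup \<alpha> i)"
proof -
  have pow: "mvar i ^ k = Poly_Mapping.single (Poly_Mapping.single i k) 1" for i :: 'n and k
    by (induction k) (simp_all add: mvar_def mult_single flip: single_add)
  have "(\<Prod>i\<in>A. mvar i ^ Poly_Mapping.lookup \<alpha> i)
      = Poly_Mapping.single (\<Sum>i\<in>A. Poly_Mapping.single i (Poly_Mapping.lookup \<alpha> i)) 1" for A
    by (induction A rule: infinite_finite_induct) (simp_all add: mult_single pow)
  moreover have "(\<Sum>i\<in>UNIV. Poly_Mapping.single i (Poly_Mapping.lookup \<alpha> i)) = \<alpha>"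
    by (intro poly_mapping_eqI) (simp add: lookup_sum lookup_single when_def)
  ultimately show ?thesis by (simp add: mult_single)
qed

definition mpoly_bernstein_coeff ::
  "real ^ 'n::finite \<Rightarrow> 'n real_mpoly \<Rightarrow> nat \<Rightarrow> ('n \<Rightarrow> nat) \<Rightarrow> real" where
  "mpoly_bernstein_coeff R f d \<kappa> = (\<Sum>\<alpha>\<in>Poly_Mapping.keys f. Poly_Mapping.lookup f \<alpha> *
     (\<Prod>i\<in>UNIV. bernstein_coeff (R $ i) (Poly_Mapping.lookup \<alpha> i) d (\<kappa> i)))"

text \<open>
  Each monomial is a product of powers of single variables, so its expansion is the product of the
  univariate ones. The same degree \<open>d\<close> is used in all variables and for all monomials of \<open>f\<close>.
\<close>

lemma mpoly_bernstein_expansion: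
  fixes R :: "real ^ 'n::finite"
  assumes R: "\<And>i. R $ i \<noteq> 0"
    and d: "\<And>\<alpha> i. \<alpha> \<in> Poly_Mapping.keys f \<Longrightarrow> Poly_Mapping.lookup \<alpha> i \<le> d"
  shows "f = (\<Sum>\<kappa>\<in>PiE UNIV (\<lambda>_. {..d}). Poly_Mapping.single 0 (mpoly_bernstein_coeff R f d \<kappa>) *
           (\<Prod>i\<in>UNIV. bernstein d (\<kappa> i) (unit_coord R i)))"
proof -
  let ?c = "\<lambda>x. Poly_Mapping.single 0 x :: 'n real_mpoly"
  let ?P = "PiE (UNIV :: 'n set) (\<lambda>_. {..d})"
  let ?B = "\<lambda>\<kappa>. \<Prod>i\<in>UNIV. bernstein d (\<kappa> i) (unit_coord R i)"
  let ?w = "\<lambda>\<alpha> \<kappa>. \<Prod>i\<in>UNIV. bernstein_coeff (R $ i) (Poly_Mapping.lookup \<alpha> i) d (\<kappa> i)"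
  have mono: "(\<Prod>i\<in>UNIV. mvar i ^ Poly_Mapping.lookup \<alpha> i) = (\<Sum>\<kappa>\<in>?P. ?c (?w \<alpha> \<kappa>) * ?B \<kappa>)"
    if "\<alpha> \<in> Poly_Mapping.keys f" for \<alpha>
  proof -
    have "(\<Prod>i\<in>UNIV. mvar i ^ Poly_Mapping.lookup \<alpha> i) = (\<Prod>i\<in>UNIV. \<Sum>k\<le>d.
        ?c (bernstein_coeff (R $ i) (Poly_Mapping.lookup \<alpha> i) d k) * bernstein d k (unit_coord R i))"
      using R d[OF that] by (intro prod.cong refl mvar_power_bernstein)
    also have "\<dots> = (\<Sum>\<kappa>\<in>?P. ?c (?w \<alpha> \<kappa>) * ?B \<kappa>)"
      by (subst prod_sum_PiE) (simp_all only: finite finite_atMost single0_prod prod.distrib)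
    finally show ?thesis .
  qed
  have "f = (\<Sum>\<alpha>\<in>Poly_Mapping.keys f. ?c (Poly_Mapping.lookup f \<alpha>) *
      (\<Prod>i\<in>UNIV. mvar i ^ Poly_Mapping.lookup \<alpha> i))"
    by (subst sum_monomials) (simp only: single_eq_prod_mvar[symmetric])
  also have "\<dots> = (\<Sum>\<alpha>\<in>Poly_Mapping.keys f. \<Sum>\<kappa>\<in>?P.
      ?c (Poly_Mapping.lookup f \<alpha> * ?w \<alpha> \<kappa>) * ?B \<kappa>)"
    by (intro sum.cong refl, subst mono) (simp_all only: single0_mult sum_distrib_left mult.assoc)
  also have "\<dots> = (\<Sum>\<kappa>\<in>?P. ?c (mpoly_bernstein_coeff R f d \<kappa>) * ?B \<kappa>)"
    unfolding mpoly_bernstein_coeff_def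
    by (subst sum.swap) (simp only: single0_sum sum_distrib_right)
  finally show ?thesis .
qed

section \<open>Bernstein coefficients of a positive polynomial\<close>

text \<open>
  The ratio is the product of the \<open>(\<kappa> - l) / (\<delta> - l)\<close> for \<open>l < j\<close>, and each of these has the limit
  of \<open>\<kappa> / \<delta>\<close>. This makes the Bernstein coefficient of index \<open>k\<close> of degree \<open>d\<close> an approximation to
  the value at \<open>k / d\<close>.
\<close>

lemma binomial_ratio_tendsto:
  fixes \<kappa> \<delta> :: "nat \<Rightarrow> nat"
  assumes \<delta>: "filterlim \<delta> at_top sequentially"
    and t: "(\<lambda>n. real (\<kappa> n) / real (\<delta> n)) \<longlonglongrightarrow> t"
  shows "(\<lambda>n. real (\<kappa> n choose j) / real (\<delta> n choose j)) \<longlonglongrightarrow> t ^ j"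
proof -
  let ?q = "\<lambda>n l. (real (\<kappa> n) / real (\<delta> n) - real l * (1 / real (\<delta> n))) /
    (1 - real l * (1 / real (\<delta> n)))"
  have inv: "(\<lambda>n. 1 / real (\<delta> n)) \<longlonglongrightarrow> 0"
    using filterlim_compose[OF filterlim_real_sequentially \<delta>]
    by (intro tendsto_divide_0[OF tendsto_const] filterlim_at_top_imp_at_infinity)
  have "(\<lambda>n. \<Prod>l=0..<j. ?q n l) \<longlonglongrightarrow> (\<Prod>l=0..<j. (t - real l * 0) / (1 - real l * 0))"
    by (intro tendsto_intros t inv) auto
  also have "(\<Prod>l=0..<j. (t - real l * 0) / (1 - real l * 0)) = t ^ j" by simp
  finally show ?thesis
  proof (rule Lim_transform_eventually)
    have "eventually (\<lambda>n. \<delta> n \<ge> 1) sequentially"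
      using \<delta> by (simp add: filterlim_at_top)
    then show "\<forall>\<^sub>F n in sequentially. (\<Prod>l=0..<j. ?q n l) = real (\<kappa> n choose j) / real (\<delta> n choose j)"
    proof eventually_elim
      case (elim n)
      have factor: "?q n l = (real (\<kappa> n) - real l) / (real (\<delta> n) - real l)" for l
      proof -
        have "real (\<kappa> n) / real (\<delta> n) - real l * (1 / real (\<delta> n)) = (real (\<kappa> n) - real l) / real (\<delta> n)"
          "1 - real l * (1 / real (\<delta> n)) = (real (\<delta> n) - real l) / real (\<delta> n)"
          using elim by (simp_all add: field_simps)
        then show ?thesis using elim by simp
      qed
      show ?case
        unfolding factor binomial_gbinomial gbinomial_prod_rev prod_dividef by simp
    qed
  qed
qed

lemma bernstein_coeff_tendsto:
  assumes "filterlim \<delta> at_top sequentially" "(\<lambda>n. real (\<kappa> n) / real (\<delta> n)) \<longlonglongrightarrow> t"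
  shows "(\<lambda>n. bernstein_coeff \<rho> m (\<delta> n) (\<kappa> n)) \<longlonglongrightarrow> (\<rho> * (2 * t - 1)) ^ m"
proof -
  have "(\<lambda>n. bernstein_coeff \<rho> m (\<delta> n) (\<kappa> n)) \<longlonglongrightarrow>
      \<rho> ^ m * (\<Sum>j\<le>m. of_nat (m choose j) * 2 ^ j * (- 1) ^ (m - j) * t ^ j)"
    unfolding bernstein_coeff_def
    by (intro tendsto_intros binomial_ratio_tendsto assms)
  also have "(\<Sum>j\<le>m. of_nat (m choose j) * 2 ^ j * (- 1) ^ (m - j) * t ^ j) = (2 * t + (- 1)) ^ m"
    unfolding binomial_ring by (intro sum.cong) (auto simp: power_mult_distrib)
  finally show ?thesis by (simp add: power_mult_distrib)
qed

text \<open>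
  If every large degree had a negative coefficient, the grid points of these coefficients would
  accumulate at some point of the unit cube, by compactness. Along the corresponding subsequence the
  coefficients converge to the value of \<open>f\<close> at the matching point of the box, which would then be at
  most 0.
\<close>

lemma mpoly_bernstein_coeff_nonneg:
  fixes R :: "real ^ 'n::finite"
  assumes R: "\<And>i. 0 < R $ i"
    and pos: "\<And>x. (\<And>i. \<bar>x $ i\<bar> \<le> R $ i) \<Longrightarrow> 0 < mpoly_value f x"
  shows "\<exists>d\<ge>D. \<forall>\<kappa>\<in>PiE UNIV (\<lambda>_. {..d}). 0 \<le> mpoly_bernstein_coeff R f d \<kappa>"
proof (rule ccontr)
  assume "\<not> ?thesis"
  moreover have "\<kappa> \<in> PiE UNIV (\<lambda>_. {..d}) \<longleftrightarrow> (\<forall>i. \<kappa> i \<le> d)" for \<kappa> :: "'n \<Rightarrow> nat" and d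
    by (auto simp: PiE_UNIV_domain)
  ultimately have "\<forall>d. \<exists>\<kappa>. d \<ge> D \<longrightarrow> (\<forall>i. \<kappa> i \<le> d) \<and> mpoly_bernstein_coeff R f d \<kappa> < 0"
    by (metis not_le)
  then obtain K where K: "\<And>d i. d \<ge> D \<Longrightarrow> K d i \<le> d"
      "\<And>d. d \<ge> D \<Longrightarrow> mpoly_bernstein_coeff R f d (K d) < 0"
    by metis
  define T :: "nat \<Rightarrow> real ^ 'n" where "T n = (\<chi> i. real (K (D + n) i) / real (D + n))" for n
  have "T n \<in> cbox 0 1" for n
    unfolding mem_box_cart T_def using K(1)[of "D + n"] by (auto simp: divide_le_eq_1 simp del: of_nat_add)
  then obtain t s where t: "t \<in> cbox 0 1" and s: "strict_mono s" and lim: "(T \<circ> s) \<longlonglongrightarrow> t"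
    using compact_cbox[of "0::real^'n" 1] unfolding compact_eq_seq_compact_metric seq_compact_def
    by (metis (no_types, lifting))
  define \<delta> where "\<delta> n = D + s n" for n
  have \<delta>: "filterlim \<delta> at_top sequentially"
    unfolding \<delta>_def by (intro filterlim_at_top_mono[OF filterlim_subseq[OF s]]) auto
  have lim_i: "(\<lambda>n. real (K (\<delta> n) i) / real (\<delta> n)) \<longlonglongrightarrow> t $ i" for i
    using tendsto_vec_nth[OF lim, of i] by (simp add: T_def \<delta>_def o_def)
  define x :: "real ^ 'n" where "x = (\<chi> i. R $ i * (2 * t $ i - 1))"
  have "(\<lambda>n. mpoly_bernstein_coeff R f (\<delta> n) (K (\<delta> n))) \<longlonglongrightarrow> mpoly_value f x"
    unfolding mpoly_bernstein_coeff_def mpoly_value_def monom_value_def x_def vec_lambda_beta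
    by (intro tendsto_intros bernstein_coeff_tendsto \<delta> lim_i)
  moreover have "mpoly_bernstein_coeff R f (\<delta> n) (K (\<delta> n)) \<le> 0" for n
    using K(2)[of "\<delta> n"] by (simp add: \<delta>_def)
  ultimately have "mpoly_value f x \<le> 0"
    by (intro LIMSEQ_le_const2) auto
  moreover have "\<bar>x $ i\<bar> \<le> R $ i" for i
  proof -
    have "\<bar>2 * t $ i - 1\<bar> \<le> 1"
      using t unfolding mem_box_cart by (auto simp: abs_le_iff dest: spec[of _ i])
    then show ?thesis using R[of i] by (simp add: x_def abs_mult mult_left_le)
  qed
  ultimately show False using pos[of x] by force
qed

lemma unit_coord_sos_l1_closure:
  assumes R: "\<And>i. 0 < R $ i"
  shows "unit_coord R i \<in> sos_l1_closure R" "1 - unit_coord R i \<in> sos_l1_closure R"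
proof -
  let ?z = "Poly_Mapping.single 0 (1 / R $ i) * mvar i"
  let ?h = "Poly_Mapping.single 0 (1 / 2) :: 'a real_mpoly"
  have z: "l1norm R ?z \<le> 1" "l1norm R (- ?z) \<le> 1"
    using R[of i]
    by (simp_all add: mvar_def mult_single l1norm_minus[OF R] l1norm_single[OF R] del: One_nat_def)
  have h: "?h \<in> sos_l1_closure R" by (intro sos_l1_closure_const[OF R]) simp
  show "unit_coord R i \<in> sos_l1_closure R"
    unfolding unit_coord_def using sos_l1_closure_mult[OF R h sos_l1_closure_one_minus[OF R z(2)]] by simp
  have "?h + ?h = 1" by (simp flip: single_add)
  then have "1 - unit_coord R i = ?h * (1 - ?z)"
    unfolding unit_coord_def by (simp add: algebra_simps)
  then show "1 - unit_coord R i \<in> sos_l1_closure R"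
    using sos_l1_closure_mult[OF R h sos_l1_closure_one_minus[OF R z(1)]] by simp
qed

lemma pos_imp_sos_l1_closure:
  fixes R :: "real ^ 'n::finite"
  assumes R: "\<And>i. 0 < R $ i"
    and pos: "\<And>x. (\<And>i. \<bar>x $ i\<bar> \<le> R $ i) \<Longrightarrow> 0 < mpoly_value f x"
  shows "f \<in> sos_l1_closure R"
proof -
  define D where
    "D = Max (insert 0 ((\<lambda>(\<alpha>, i). Poly_Mapping.lookup \<alpha> i) ` (Poly_Mapping.keys f \<times> UNIV)))"
  have D: "Poly_Mapping.lookup \<alpha> i \<le> D" if "\<alpha> \<in> Poly_Mapping.keys f" for \<alpha> i
    unfolding D_def by (intro Max_ge) (use that in force)+
  obtain d where d: "d \<ge> D" "\<And>\<kappa>. \<kappa> \<in> PiE UNIV (\<lambda>_. {..d}) \<Longrightarrow> 0 \<le> mpoly_bernstein_coeff R f d \<kappa>"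
    using mpoly_bernstein_coeff_nonneg[OF R pos, of D] by auto
  have "(\<Sum>\<kappa>\<in>PiE UNIV (\<lambda>_. {..d}). Poly_Mapping.single 0 (mpoly_bernstein_coeff R f d \<kappa>) *
           (\<Prod>i\<in>UNIV. bernstein d (\<kappa> i) (unit_coord R i))) \<in> sos_l1_closure R"
    unfolding bernstein_def
    by (intro sos_l1_closure_sum[OF R] sos_l1_closure_mult[OF R] sos_l1_closure_prod[OF R] sos_l1_closure_const[OF R]
        d(2) sos_l1_closure_power[OF R] sos_l1_closure_of_nat[OF R] unit_coord_sos_l1_closure[OF R])
  also have "(\<Sum>\<kappa>\<in>PiE UNIV (\<lambda>_. {..d}). Poly_Mapping.single 0 (mpoly_bernstein_coeff R f d \<kappa>) *
           (\<Prod>i\<in>UNIV. bernstein d (\<kappa> i) (unit_coord R i))) = f"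
    using R D d(1)
    by (intro mpoly_bernstein_expansion[symmetric])
       (auto simp: less_imp_neq[symmetric] intro: order_trans)
  finally show ?thesis .
qed

lemma nonneg_imp_sos_l1_closure:
  fixes R :: "real ^ 'n::finite"
  assumes R: "\<And>i. 0 < R $ i"
    and nonneg: "\<And>x. (\<And>i. \<bar>x $ i\<bar> \<le> R $ i) \<Longrightarrow> 0 \<le> mpoly_value f x"
  shows "f \<in> sos_l1_closure R"
proof (rule sos_l1_closure_closed[OF R])
  fix e :: real assume "0 < e"
  let ?c = "Poly_Mapping.single 0 (e / 2) :: 'n real_mpoly"
  have "f + ?c \<in> sos_l1_closure R"
    using nonneg \<open>0 < e\<close> by (intro pos_imp_sos_l1_closure R) (simp add: add_nonneg_pos)
  moreover have "l1norm R (f - (f + ?c)) < e"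
    using \<open>0 < e\<close> by (simp add: l1norm_minus[OF R] l1norm_single[OF R])
  ultimately show "\<exists>g\<in>sos_l1_closure R. l1norm R (f - g) < e" by blast
qed

section \<open>Evaluation inside the box is continuous for the supremum norm\<close>

lemma monom_value_abs: "\<bar>monom_value x \<alpha>\<bar> = (\<Prod>i\<in>UNIV. \<bar>x $ i\<bar> ^ Poly_Mapping.lookup \<alpha> i)"
  by (simp add: monom_value_def abs_prod power_abs)

text \<open>
  The finitely many exponents fit into a cube, over which the sum factors into partial sums of
  geometric series.
\<close>

lemma sum_monomials_le_geometric:
  fixes q :: "'n::finite \<Rightarrow> real"
  assumes q: "\<And>i. 0 \<le> q i" "\<And>i. q i < 1" and F: "finite F"
  shows "(\<Sum>\<alpha>\<in>F. \<Prod>i\<in>UNIV. q i ^ Poly_Mapping.lookup \<alpha> i) \<le> (\<Prod>i\<in>UNIV. 1 / (1 - q i))"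
proof -
  define m where
    "m = Max (insert 0 ((\<lambda>(\<alpha>, i). Poly_Mapping.lookup \<alpha> i) ` (F \<times> (UNIV :: 'n set))))"
  have m: "Poly_Mapping.lookup \<alpha> i \<le> m" if "\<alpha> \<in> F" for \<alpha> i
    unfolding m_def by (intro Max_ge) (use that F in force)+
  have "(\<Sum>\<alpha>\<in>F. \<Prod>i\<in>UNIV. q i ^ Poly_Mapping.lookup \<alpha> i)
      = (\<Sum>\<kappa>\<in>Poly_Mapping.lookup ` F. \<Prod>i\<in>UNIV. q i ^ \<kappa> i)"
    by (subst sum.reindex) (auto simp: inj_on_def poly_mapping_eqI)
  also have "\<dots> \<le> (\<Sum>\<kappa>\<in>PiE UNIV (\<lambda>_. {..m}). \<Prod>i\<in>UNIV. q i ^ \<kappa> i)"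
    using m q by (intro sum_mono2 finite_PiE prod_nonneg) (auto simp: PiE_UNIV_domain)
  also have "\<dots> = (\<Prod>i\<in>UNIV. \<Sum>j\<le>m. q i ^ j)"
    by (subst prod_sum_PiE) auto
  also have "\<dots> \<le> (\<Prod>i\<in>UNIV. 1 / (1 - q i))"
  proof (intro prod_mono conjI sum_nonneg)
    fix i
    have "(\<Sum>j\<le>m. q i ^ j) \<le> suminf (\<lambda>j. q i ^ j)"
      using q by (intro sum_le_suminf summable_geometric) auto
    also have "\<dots> = 1 / (1 - q i)"
      using q by (intro suminf_geometric) auto
    finally show "(\<Sum>j\<le>m. q i ^ j) \<le> 1 / (1 - q i)" .
  qed (use q in auto)
  finally show ?thesis .
qed

lemma mpoly_value_le_supnorm:
  fixes R :: "real ^ 'n::finite"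
  assumes x: "\<And>i. \<bar>x $ i\<bar> < R $ i"
  shows "\<bar>mpoly_value f x\<bar> \<le> supnorm R f * (\<Prod>i\<in>UNIV. 1 / (1 - \<bar>x $ i\<bar> / R $ i))"
proof -
  have R: "0 < R $ i" for i using x[of i] by linarith
  let ?q = "\<lambda>i. \<bar>x $ i\<bar> / R $ i"
  have mx: "\<bar>monom_value x \<alpha>\<bar> =
      monom_value R \<alpha> * (\<Prod>i\<in>UNIV. ?q i ^ Poly_Mapping.lookup \<alpha> i)" for \<alpha>
    unfolding monom_value_abs unfolding monom_value_def prod.distrib[symmetric] power_mult_distrib[symmetric]
    using R by (intro prod.cong refl arg_cong2[where f = "(^)"]) (simp add: less_imp_neq[symmetric])
  have "\<bar>mpoly_value f x\<bar> \<le>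
      (\<Sum>\<alpha>\<in>Poly_Mapping.keys f. \<bar>Poly_Mapping.lookup f \<alpha>\<bar> * \<bar>monom_value x \<alpha>\<bar>)"
    unfolding mpoly_value_def by (intro order_trans[OF sum_abs]) (simp add: abs_mult)
  also have "\<dots> \<le> (\<Sum>\<alpha>\<in>Poly_Mapping.keys f. supnorm R f *
      (\<Prod>i\<in>UNIV. ?q i ^ Poly_Mapping.lookup \<alpha> i))"
    unfolding mx mult.assoc[symmetric]
    by (intro sum_mono mult_right_mono supnorm_upper prod_nonneg)
       (auto intro!: divide_nonneg_pos zero_le_power R)
  also have "\<dots> = supnorm R f *
      (\<Sum>\<alpha>\<in>Poly_Mapping.keys f. \<Prod>i\<in>UNIV. ?q i ^ Poly_Mapping.lookup \<alpha> i)"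
    by (simp add: sum_distrib_left)
  also have "\<dots> \<le> supnorm R f * (\<Prod>i\<in>UNIV. 1 / (1 - ?q i))"
  proof (intro mult_left_mono sum_monomials_le_geometric)
    show "0 \<le> supnorm R f"
      by (intro order_trans[OF _ supnorm_upper[of f 0 R]]) simp
  qed (use x R in \<open>auto simp: divide_less_eq intro!: divide_nonneg_pos\<close>)
  finally show ?thesis .
qed

lemma supnorm_limit_nonneg:
  fixes R :: "real ^ 'n::finite"
  assumes R: "\<And>i. 0 < R $ i"
    and f: "\<And>e. 0 < e \<Longrightarrow> \<exists>s\<in>sums_of_squares. supnorm R (f - s) < e"
    and x: "\<And>i. \<bar>x $ i\<bar> \<le> R $ i"
  shows "0 \<le> mpoly_value f x"
proof -
  have inside: "0 \<le> mpoly_value f y" if y: "\<And>i. \<bar>y $ i\<bar> < R $ i" for y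
  proof (rule ccontr)
    assume neg: "\<not> 0 \<le> mpoly_value f y"
    define M where "M = (\<Prod>i\<in>UNIV. 1 / (1 - \<bar>y $ i\<bar> / R $ i))"
    have M: "M > 0" unfolding M_def using y R by (intro prod_pos) (auto simp: divide_less_eq)
    obtain s where s: "s \<in> sums_of_squares" "supnorm R (f - s) < - mpoly_value f y / M"
      using f[of "- mpoly_value f y / M"] neg M by (auto simp: field_simps)
    have "f = (f - s) + s" by simp
    then have "mpoly_value f y = mpoly_value (f - s) y + mpoly_value s y"
      by (metis mpoly_value_add)
    moreover have "\<bar>mpoly_value (f - s) y\<bar> < - mpoly_value f y"
      using mpoly_value_le_supnorm[OF y, of "f - s"] s(2) M
      unfolding M_def[symmetric] by (simp add: field_simps)
    ultimately show False
      using mpoly_value_sums_of_squares_nonneg[OF s(1), of y] by linarith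
  qed
  (* A boundary point is the limit of the interior points t x as t increases to 1. *)
  have "((\<lambda>t. mpoly_value f (t *\<^sub>R x)) \<longlongrightarrow> mpoly_value f (1 *\<^sub>R x)) (at_left 1)"
    unfolding mpoly_value_def monom_value_def by (intro tendsto_intros)
  moreover have "eventually (\<lambda>t::real. 0 < t \<and> t < 1) (at_left 1)"
    using eventually_at_left_real[of 0 1] by simp
  then have "eventually (\<lambda>t. 0 \<le> mpoly_value f (t *\<^sub>R x)) (at_left 1)"
  proof eventually_elim
    case (elim t)
    show ?case
    proof (rule inside)
      fix i
      have "t * \<bar>x $ i\<bar> \<le> t * R $ i" using x elim by (intro mult_left_mono) auto
      also have "\<dots> < R $ i" using elim R[of i] by simp
      finally show "\<bar>(t *\<^sub>R x) $ i\<bar> < R $ i" using elim by (simp add: abs_mult)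
    qed
  qed
  ultimately have "0 \<le> mpoly_value f (1 *\<^sub>R x)"
    by (intro tendsto_lowerbound) (auto simp: trivial_limit_at_left_real)
  then show ?thesis by simp
qed

section \<open>The closure for every norm between the two extremes\<close>

lemma norm_closure_iff:
  assumes "Metric_space UNIV (\<lambda>f g. N (f - g))"
  shows "f \<in> norm_closure N S \<longleftrightarrow> (\<forall>e>0. \<exists>s\<in>S. N (f - s) < e)"
  unfolding norm_closure_def
  by (simp add: Metric_space.metric_closure_of[OF assms] Metric_space.in_mball[OF assms])

lemma norm_closure_sums_of_squares:
  fixes R :: "real ^ 'n::finite"
  assumes R: "\<And>i. 0 < R $ i"
    and metric: "Metric_space UNIV (\<lambda>f g. N (f - g))"
    and lower: "\<And>f. supnorm R f \<le> N f" and upper: "\<And>f. N f \<le> l1norm R f"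
  shows "norm_closure N sums_of_squares = Psd {x. \<forall>i. x $ i \<in> {- (R $ i) .. R $ i}}"
proof -
  have box: "{x. \<forall>i. x $ i \<in> {- (R $ i) .. R $ i}} = {x. \<forall>i. \<bar>x $ i\<bar> \<le> R $ i}"
    by (rule Collect_cong) (simp add: abs_le_iff, metis minus_le_iff)
  show ?thesis
  proof (intro equalityI subsetI)
    fix f assume "f \<in> norm_closure N sums_of_squares"
    then have "\<exists>s\<in>sums_of_squares. supnorm R (f - s) < e" if "0 < e" for e
      using that lower unfolding norm_closure_iff[OF metric] by (meson le_less_trans)
    then have "0 \<le> mpoly_value f x" if "\<And>i. \<bar>x $ i\<bar> \<le> R $ i" for x
      by (rule supnorm_limit_nonneg[OF R _ that])
    then show "f \<in> Psd {x. \<forall>i. x $ i \<in> {- (R $ i) .. R $ i}}"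
      unfolding Psd_def box by blast
  next
    fix f :: "'n real_mpoly" assume "f \<in> Psd {x. \<forall>i. x $ i \<in> {- (R $ i) .. R $ i}}"
    then have "f \<in> sos_l1_closure R"
      unfolding Psd_def box by (intro nonneg_imp_sos_l1_closure R) auto
    then show "f \<in> norm_closure N sums_of_squares"
      using upper unfolding norm_closure_iff[OF metric] sos_l1_closure_def
      by (auto intro: le_less_trans) (meson le_less_trans)
  qed
qed

lemma supnorm_le_l1norm:
  assumes R: "\<And>i. 0 < R $ i"
  shows "supnorm R f \<le> l1norm R f"
  unfolding supnorm_def
proof (rule cSUP_least)
  fix \<alpha>
  show "\<bar>Poly_Mapping.lookup f \<alpha>\<bar> * monom_value R \<alpha> \<le> l1norm R f"
  proof (cases "\<alpha> \<in> Poly_Mapping.keys f")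
    case True
    then show ?thesis unfolding l1norm_def
      by (intro member_le_sum[of \<alpha> _ "\<lambda>\<alpha>. \<bar>Poly_Mapping.lookup f \<alpha>\<bar> * monom_value R \<alpha>"])
         (auto intro!: mult_nonneg_nonneg less_imp_le[OF monom_value_pos] R)
  next
    case False
    then show ?thesis by (simp add: in_keys_iff l1norm_nonneg[OF R])
  qed
qed simp

text \<open>
  With \<open>c\<^sub>\<alpha> = \<bar>f\<^sub>\<alpha>\<bar> R\<^sup>\<alpha>\<close> the norm is \<open>(\<Sum> c\<^sub>\<alpha>\<^sup>p)\<^bsup>1/p\<^esup>\<close>. A single term gives the lower bound; with
  \<open>S = \<Sum> c\<^sub>\<alpha>\<close> the upper bound is \<open>\<Sum> c\<^sub>\<alpha>\<^sup>p \<le> \<Sum> c\<^sub>\<alpha> S\<^bsup>p-1\<^esup> = S\<^sup>p\<close>.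
\<close>

lemma supnorm_le_pnorm_le_l1norm:
  fixes r :: "real ^ 'n::finite"
  assumes p: "1 \<le> p" and r: "\<And>i. 0 < r $ i"
  defines "R \<equiv> \<chi> i. r $ i powr (1 / p)"
  shows "supnorm R f \<le> pnorm p r f" "pnorm p r f \<le> l1norm R f"
proof -
  let ?K = "Poly_Mapping.keys f"
  define c where "c \<alpha> = \<bar>Poly_Mapping.lookup f \<alpha>\<bar> * monom_value R \<alpha>" for \<alpha>
  have R: "0 < R $ i" for i using r[of i] by (simp add: R_def)
  have mv: "monom_value R \<alpha> powr p = monom_value r \<alpha>" for \<alpha>
  proof -
    have "monom_value R \<alpha> powr p = (\<Prod>i\<in>UNIV. (R $ i ^ Poly_Mapping.lookup \<alpha> i) powr p)"
      unfolding monom_value_def by (rule prod_powr_distrib)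
    also have "\<dots> = monom_value r \<alpha>"
      unfolding monom_value_def
    proof (intro prod.cong refl)
      fix i
      have "(R $ i ^ k) powr p = (R $ i powr p) ^ k" for k
        using R[of i] by (simp add: powr_powr powr_realpow[symmetric] mult.commute)
      then show "(R $ i ^ Poly_Mapping.lookup \<alpha> i) powr p = r $ i ^ Poly_Mapping.lookup \<alpha> i"
        using r[of i] p by (simp add: R_def powr_powr)
    qed
    finally show ?thesis .
  qed
  have c0: "0 \<le> c \<alpha>" for \<alpha>
    unfolding c_def by (intro mult_nonneg_nonneg less_imp_le[OF monom_value_pos] R) auto
  have cp: "c \<alpha> powr p = \<bar>Poly_Mapping.lookup f \<alpha>\<bar> powr p * monom_value r \<alpha>" for \<alpha>
    unfolding c_def using less_imp_le[OF monom_value_pos[OF R]] by (simp add: powr_mult mv)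
  have pn: "pnorm p r f = (\<Sum>\<alpha>\<in>?K. c \<alpha> powr p) powr (1 / p)"
    by (simp add: pnorm_def cp)
  show "supnorm R f \<le> pnorm p r f"
    unfolding supnorm_def
  proof (rule cSUP_least)
    fix \<alpha>
    show "\<bar>Poly_Mapping.lookup f \<alpha>\<bar> * monom_value R \<alpha> \<le> pnorm p r f"
    proof (cases "\<alpha> \<in> ?K")
      case True
      have "c \<alpha> = (c \<alpha> powr p) powr (1 / p)"
        using c0 p by (simp add: powr_powr)
      also have "\<dots> \<le> pnorm p r f"
        unfolding pn using p True by (intro powr_mono2 member_le_sum) auto
      finally show ?thesis by (simp add: c_def)
    next
      case False
      then show ?thesis by (simp add: in_keys_iff pnorm_def)
    qed
  qed simp
  define S where "S = (\<Sum>\<alpha>\<in>?K. c \<alpha>)"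
  have S0: "0 \<le> S" unfolding S_def by (intro sum_nonneg c0)
  have split: "x powr p = x * x powr (p - 1)" if "0 \<le> x" for x :: real
    using that by (cases "x = 0") (auto simp: powr_mult_base)
  have "(\<Sum>\<alpha>\<in>?K. c \<alpha> powr p) \<le> (\<Sum>\<alpha>\<in>?K. c \<alpha> * S powr (p - 1))"
  proof (intro sum_mono)
    fix \<alpha> assume "\<alpha> \<in> ?K"
    then have "c \<alpha> \<le> S" unfolding S_def by (intro member_le_sum c0) auto
    then show "c \<alpha> powr p \<le> c \<alpha> * S powr (p - 1)"
      using c0 p by (simp add: split mult_left_mono powr_mono2)
  qed
  also have "\<dots> = S powr p"
    unfolding sum_distrib_right[symmetric] S_def[symmetric] by (rule split[OF S0, symmetric])
  finally have "pnorm p r f \<le> (S powr p) powr (1 / p)"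
    unfolding pn using p by (intro powr_mono2 sum_nonneg) auto
  also have "\<dots> = S" using S0 p by (simp add: powr_powr)
  finally show "pnorm p r f \<le> l1norm R f"
    by (simp add: S_def c_def l1norm_def)
qed

theorem theorem3p12:
  fixes r :: "real ^ 'n::finite"
  assumes "\<And>i. 0 < r $ i"
  shows "(\<forall>p::real. 1 \<le> p \<longrightarrow>
            norm_closure (pnorm p r) (sums_of_squares :: 'n real_mpoly set)
              = Psd {x. \<forall>i. x $ i \<in> {- (r $ i powr (1 / p)) .. r $ i powr (1 / p)}})
       \<and> norm_closure (supnorm r) (sums_of_squares :: 'n real_mpoly set)
           = Psd {x. \<forall>i. x $ i \<in> {- (r $ i) .. r $ i}}"
proof (intro conjI allI impI)
  fix p :: real assume p: "1 \<le> p"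
  have "0 < (\<chi> i. r $ i powr (1 / p)) $ j" for j
    using assms[of j] by simp
  then show "norm_closure (pnorm p r) (sums_of_squares :: 'n real_mpoly set)
      = Psd {x. \<forall>i. x $ i \<in> {- (r $ i powr (1 / p)) .. r $ i powr (1 / p)}}"
    using norm_closure_sums_of_squares[of "\<chi> i. r $ i powr (1 / p)" "pnorm p r"]
      Metric_space_pnorm[OF p assms] supnorm_le_pnorm_le_l1norm[OF p assms] by simp
next
  show "norm_closure (supnorm r) (sums_of_squares :: 'n real_mpoly set)
      = Psd {x. \<forall>i. x $ i \<in> {- (r $ i) .. r $ i}}"
    by (intro norm_closure_sums_of_squares assms Metric_space_supnorm supnorm_le_l1norm order_refl)
qed

end
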